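(* Let $(X,\mathcal A,\mu,T)$ be a conservative ergodic infinite measure preserving system (as in the context), and let $N$ be a square-integrable $T$-point process with intensity $\mu$, defined on $(\Omega,\mathscr F,\mathbb P,S)$. Then $N$ almost surely gives finite measure to any $T$-orbit; that is, for $\mathbb P$-a.e. $\omega$, for every $x\in X$, $N(\omega)(\{T^kx: k\in\mathbb Z\})<\infty$.
   Context: Setting. $X$ is a complete separable metric space with Borel $\sigma$-algebra $\mathcal A$; $\mu$ is a measure on $(X,\mathcal A)$ that is boundedly finite (finite on bounded Borel sets), with $\mu(X)=\infty$; $T:X\to X$ is invertible and preserves $\mu$, and $(X,\mathcal A,\mu,T)$ is conservative and ergodic. Put $\mathcal A_f=\{A\in\mathcal A: 0<\mu(A)<\infty\}$. $X^*$ is the set of boundedly finite simple counting measures $\xi=\sum_{i\in I}\delta_{x_i}$ ($I$ at most countable, $x_i\ne x_j$ for $i\neq j$), and $\mathcal A^*$ is the $\sigma$-algebra on $X^*$ generated by the maps $\xi\mapsto \xi(A)$, $A$ bounded Borel. $T$-point process. $(\Omega,\mathscr F,\mathbb P)$ is a probability space and $S$ an invertible measure preserving transformation of it. A $T$-point process defined on $(\Omega,\mathscr F,\mathbb P,S)$ is a measurable map $N:\Omega\to X^*$ such that (i) for each $A\in\mathcal A$ with $\mu(A)=0$, $N(\omega)(A)=0$ for $\mathbb P$-a.e. $\omega$; (ii) for $\mathbb P$-a.e. $\omega$, for all $A\in\mathcal A$, $N(S\omega)(A)=N(\omega)(T^{-1}A)$. Its intensity is the measure $A\mapsto\mathbb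 E[N(A)]$. It is square-integrable if $\mathbb E[N(A)^2]<\infty$ for all $A\in\mathcal A_f$. *)

theory Defs
  imports "HOL-Probability.Probability"
begin

definition invertible_mpt :: "'a measure \<Rightarrow> ('a \<Rightarrow> 'a) \<Rightarrow> bool" where
  "invertible_mpt M T \<longleftrightarrow>
     T \<in> measurable M M \<and>
     bij_betw T (space M) (space M) \<and>
     inv_into (space M) T \<in> measurable M M \<and>
     distr M M T = M"

text \<open>Conservativity: every wandering set is null.\<close>

definition conservative :: "'a measure \<Rightarrow> ('a \<Rightarrow> 'a) \<Rightarrow> bool" where
  "conservative M T \<longleftrightarrow>
     (\<forall>W\<in>sets M. disjoint_family (\<lambda>n::nat. (T ^^ n) -` W \<inter> space M) \<longrightarrow> emeasure M W = 0)"

definition ergodic :: "'a measure \<Rightarrow> ('a \<Rightarrow> 'a) \<Rightarrow> bool" where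
  "ergodic M T \<longleftrightarrow>
     (\<forall>A\<in>sets M. T -` A \<inter> space M = A \<longrightarrow> emeasure M A = 0 \<or> emeasure M (space M - A) = 0)"

definition boundedly_finite :: "'a::metric_space measure \<Rightarrow> bool" where
  "boundedly_finite M \<longleftrightarrow> (\<forall>A\<in>sets borel. bounded A \<longrightarrow> emeasure M A < \<infinity>)"

definition finite_positive_sets :: "'a measure \<Rightarrow> 'a set set" where
  "finite_positive_sets M = {A \<in> sets M. 0 < emeasure M A \<and> emeasure M A < \<infinity>}"

text \<open>
  The sum of Dirac masses at the points of a countable set \<open>D\<close> is written as an
  integral over the counting measure on \<open>D\<close>; since \<open>D\<close> is a set, the atoms are
  pairwise distinct, i.e. the counting measure is simple.
\<close>

definition configurations :: "'a::metric_space measure set" where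
  "configurations =
     {\<xi>. sets \<xi> = sets borel \<and> boundedly_finite \<xi> \<and>
         (\<exists>D. countable D \<and>
            (\<forall>A\<in>sets borel. emeasure \<xi> A = (\<integral>\<^sup>+ x. emeasure (return borel x) A \<partial>count_space D)))}"

definition configuration_space :: "'a::metric_space measure measure" where
  "configuration_space =
     sigma configurations
       {{\<xi> \<in> configurations. emeasure \<xi> A \<in> B} | A B.
          A \<in> sets borel \<and> bounded A \<and> B \<in> sets borel}"

definition T_point_process ::
  "'w measure \<Rightarrow> ('w \<Rightarrow> 'w) \<Rightarrow> 'a::polish_space measure \<Rightarrow> ('a \<Rightarrow> 'a) \<Rightarrow> ('w \<Rightarrow> 'a measure) \<Rightarrow> bool"
where
  "T_point_process P S \<mu> T N \<longleftrightarrow>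
     N \<in> measurable P configuration_space \<and>
     (\<forall>A\<in>sets \<mu>. emeasure \<mu> A = 0 \<longrightarrow> (AE \<omega> in P. emeasure (N \<omega>) A = 0)) \<and>
     (AE \<omega> in P. \<forall>A\<in>sets \<mu>. emeasure (N (S \<omega>)) A = emeasure (N \<omega>) (T -` A \<inter> space \<mu>))"

definition intensity :: "'w measure \<Rightarrow> ('w \<Rightarrow> 'a measure) \<Rightarrow> 'a set \<Rightarrow> ennreal" where
  "intensity P N A = (\<integral>\<^sup>+ \<omega>. emeasure (N \<omega>) A \<partial>P)"

definition square_integrable :: "'w measure \<Rightarrow> 'a measure \<Rightarrow> ('w \<Rightarrow> 'a measure) \<Rightarrow> bool" where
  "square_integrable P \<mu> N \<longleftrightarrow>
     (\<forall>A\<in>finite_positive_sets \<mu>. (\<integral>\<^sup>+ \<omega>. (emeasure (N \<omega>) A)\<^sup>2 \<partial>P) < \<infinity>)"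

definition int_iterate :: "('a \<Rightarrow> 'a) \<Rightarrow> int \<Rightarrow> 'a \<Rightarrow> 'a" where
  "int_iterate T k = (if k \<ge> 0 then T ^^ nat k else inv T ^^ nat (- k))"

definition full_orbit :: "('a \<Rightarrow> 'a) \<Rightarrow> 'a \<Rightarrow> 'a set" where
  "full_orbit T x = {int_iterate T k x | k. True}"

text \<open>
  A countable subset of a metric space is Borel. So an orbit is in the domain of the
  measures in \<^const>\<open>configurations\<close>, and the value of \<^const>\<open>emeasure\<close> on it is not
  the default value for non-measurable sets.
\<close>

lemma full_orbit_borel: "full_orbit T (x::'a::metric_space) \<in> sets borel"
proof -
  have "full_orbit T x = range (\<lambda>k. int_iterate T k x)"
    by (auto simp: full_orbit_def)
  then have "countable (full_orbit T x)"
    by simp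
  then show ?thesis
    by (auto intro: sets.countable)
qed

end

theory Submission
  imports Defs
begin

text \<open>
  Write \<open>O\<^sub>n(x) = {T\<^sup>k x : -n \<le> k \<le> n}\<close>. The proof bounds, uniformly in \<open>n\<close>, the expected number of
  pairs of points of the process in which the second lies on the orbit segment of the first,
  \<open>\<rho>\<^sub>n(A) = E[#{(x, y) : x, y \<in> N, x \<in> A, y \<in> O\<^sub>n(x)}]\<close>.

  Three facts combine. First, the law of \<open>N\<close> is \<open>T\<close>-invariant, so \<open>\<rho>\<^sub>n\<close> is a \<open>T\<close>-invariant measure; it
  is dominated by \<open>(2n + 1) \<mu>\<close> because \<open>N\<close> is simple. Ergodicity then leaves no room for local
  variation: if \<open>\<rho>\<^sub>n(A) > c \<mu>(A)\<close> for a single set \<open>A\<close> of finite measure, then \<open>\<rho>\<^sub>n \<ge> c \<mu>\<close> on all Borel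
  sets (\<open>invariant_measure_dominates\<close>). Secondly, square integrability is automatically uniform: there
  are \<open>\<delta> > 0\<close> and \<open>K\<close> with \<open>E[N(B)\<^sup>2] \<le> K\<close> whenever \<open>\<mu>(B) \<le> \<delta>\<close> (\<open>second_moment_uniform_bound\<close>).
  Thirdly, since \<open>\<mu>\<close> is infinite and has no atoms, for each \<open>n\<close> there are sets \<open>D\<close> and \<open>B\<close> with
  \<open>O\<^sub>n(x) \<subseteq> B\<close> for all \<open>x \<in> D\<close>, \<open>\<mu>(D) \<ge> \<delta> / 2\<close> and \<open>\<mu>(B) \<le> \<delta>\<close> (\<open>exists_almost_invariant_set\<close>).
  All pairs counted by \<open>\<rho>\<^sub>n(D)\<close> lie in \<open>B \<times> B\<close>, so \<open>\<rho>\<^sub>n(D) \<le> E[N(B)\<^sup>2] \<le> K\<close>; a constant \<open>c\<close> with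
  \<open>c \<delta> / 2 > K\<close> can therefore never satisfy \<open>\<rho>\<^sub>n \<ge> c \<mu>\<close>, and \<open>\<rho>\<^sub>n(A) \<le> c \<mu>(A)\<close> for every \<open>n\<close> and every \<open>A\<close>
  of finite measure.

  Letting \<open>n\<close> tend to infinity, the number of pairs \<open>(x, y)\<close> of points of \<open>N\<close> on a common orbit with
  \<open>x\<close> in a given ball has finite expectation, hence is almost surely finite. An orbit that
  carries infinitely many points of \<open>N\<close> would make this number infinite for every ball containing
  one of them.
\<close>

section \<open>Orbits of a bijection\<close>

lemma int_iterate_0 [simp]: "int_iterate T 0 x = x"
  by (simp add: int_iterate_def)

lemma int_iterate_plus_1:
  assumes "bij T"
  shows "int_iterate T (k + 1) x = T (int_iterate T k x)"
proof (cases "k \<ge> 0")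
  case True
  then have "nat (k + 1) = Suc (nat k)"
    by simp
  with True show ?thesis
    by (simp add: int_iterate_def)
next
  case False
  then have m: "nat (- k) = Suc (nat (- (k + 1)))"
    by linarith
  have "T (inv T y) = y" for y
    using assms by (simp add: bij_is_surj surj_f_inv_f)
  then have "int_iterate T k x = inv T (int_iterate T (k + 1) x)"
    using False m by (cases "k = - 1") (simp_all add: int_iterate_def)
  then show ?thesis
    using \<open>\<And>y. T (inv T y) = y\<close> by simp
qed

lemma int_iterate_add:
  assumes "bij T"
  shows "int_iterate T (j + k) x = int_iterate T j (int_iterate T k x)"
proof (induction j rule: int_induct[where k = 0])
  case base
  show ?case by simp
next
  case (step1 i)
  then show ?case
    using int_iterate_plus_1[OF assms, of "i + k" x]
      int_iterate_plus_1[OF assms, of i "int_iterate T k x"]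
    by (simp add: algebra_simps)
next
  case (step2 i)
  have "T (int_iterate T (i - 1 + k) x) = T (int_iterate T (i - 1) (int_iterate T k x))"
    using step2 int_iterate_plus_1[OF assms, of "i - 1 + k" x]
      int_iterate_plus_1[OF assms, of "i - 1" "int_iterate T k x"]
    by (simp add: algebra_simps)
  then show ?case
    using assms by (simp add: bij_is_inj inj_eq)
qed

lemma int_iterate_inverse [simp]:
  assumes "bij T"
  shows "int_iterate T k (int_iterate T (- k) x) = x" "int_iterate T (- k) (int_iterate T k x) = x"
  using int_iterate_add[OF assms, of k "- k" x] int_iterate_add[OF assms, of "- k" k x] by simp_all

lemma int_iterate_commute:
  assumes "bij T"
  shows "int_iterate T k (T x) = T (int_iterate T k x)"
  using int_iterate_add[OF assms, of k 1 x] int_iterate_plus_1[OF assms, of k x]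
    int_iterate_plus_1[OF assms, of 0 x] by simp

lemma int_iterate_in_full_orbit: "int_iterate T k x \<in> full_orbit T x"
  by (auto simp: full_orbit_def)

lemma self_in_full_orbit: "x \<in> full_orbit T x"
  using int_iterate_in_full_orbit[of T 0 x] by simp

lemma full_orbit_eq:
  assumes "bij T" "y \<in> full_orbit T x"
  shows "full_orbit T y = full_orbit T x"
proof -
  obtain k where k: "y = int_iterate T k x"
    using assms(2) by (auto simp: full_orbit_def)
  have "int_iterate T j y = int_iterate T (j + k) x" for j
    by (simp add: k int_iterate_add[OF assms(1)])
  moreover have "int_iterate T j x = int_iterate T (j - k) y" for j
    using int_iterate_add[OF assms(1), of "j - k" k x] by (simp add: k)
  ultimately show ?thesis
    unfolding full_orbit_def by blast
qed

lemma full_orbit_step: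
  assumes "bij T"
  shows "full_orbit T (T x) = full_orbit T x"
  using full_orbit_eq[OF assms, of "T x" x] int_iterate_in_full_orbit[of T 1 x]
    int_iterate_plus_1[OF assms, of 0 x] by simp

definition orbit_segment :: "('a \<Rightarrow> 'a) \<Rightarrow> nat \<Rightarrow> 'a \<Rightarrow> 'a set" where
  "orbit_segment T n x = (\<lambda>k. int_iterate T k x) ` {- int n..int n}"

lemma card_orbit_segment_le:
  "finite (orbit_segment T n x)" "card (orbit_segment T n x) \<le> 2 * n + 1"
proof -
  have "card (orbit_segment T n x) \<le> card {- int n..int n}"
    unfolding orbit_segment_def by (rule card_image_le) simp
  then show "card (orbit_segment T n x) \<le> 2 * n + 1"
    by simp
qed (simp add: orbit_segment_def)

lemma orbit_segment_step:
  assumes "bij T"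
  shows "T y \<in> orbit_segment T n (T x) \<longleftrightarrow> y \<in> orbit_segment T n x"
  using assms by (auto simp: orbit_segment_def int_iterate_commute bij_is_inj inj_eq)

lemma orbit_segment_mono: "m \<le> n \<Longrightarrow> orbit_segment T m x \<subseteq> orbit_segment T n x"
  by (auto simp: orbit_segment_def)

lemma Union_orbit_segment: "(\<Union>n. orbit_segment T n x) = full_orbit T x"
proof -
  have "int_iterate T k x \<in> orbit_segment T (nat \<bar>k\<bar>) x" for k
    unfolding orbit_segment_def by (intro imageI) auto
  moreover have "orbit_segment T n x \<subseteq> full_orbit T x" for n
    by (auto simp: full_orbit_def orbit_segment_def)
  ultimately show ?thesis
    unfolding full_orbit_def by blast
qed

definition orbit_saturation :: "('a \<Rightarrow> 'a) \<Rightarrow> 'a set \<Rightarrow> 'a set" where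
  "orbit_saturation T F = (\<Union>k. int_iterate T k -` F)"

text \<open>
  Strict invariance, not only invariance up to null sets, is what the definition of ergodicity
  asks for.
\<close>

lemma vimage_orbit_saturation:
  assumes "bij T"
  shows "T -` orbit_saturation T F = orbit_saturation T F"
proof -
  have "x \<in> orbit_saturation T F \<longleftrightarrow> full_orbit T x \<inter> F \<noteq> {}" for x
    by (auto simp: orbit_saturation_def full_orbit_def)
  with full_orbit_step[OF assms] show ?thesis
    by auto
qed

definition invariant_measure :: "('a::topological_space \<Rightarrow> 'a) \<Rightarrow> 'a measure \<Rightarrow> bool" where
  "invariant_measure T \<nu> \<longleftrightarrow>
     sets \<nu> = sets borel \<and> (\<forall>A\<in>sets borel. emeasure \<nu> (T -` A) = emeasure \<nu> A)"

lemma measurable_int_iterate: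
  assumes "T \<in> borel_measurable borel" "inv T \<in> borel_measurable borel"
  shows "int_iterate T k \<in> borel_measurable borel"
  using assms by (auto simp: int_iterate_def intro!: measurable_compose_n)

lemma vimage_borel: "f \<in> borel_measurable borel \<Longrightarrow> A \<in> sets borel \<Longrightarrow> f -` A \<in> sets borel"
  using measurable_sets[of f borel borel A] by simp

lemma emeasure_invariant_int_iterate:
  assumes "bij T" and T: "T \<in> borel_measurable borel" "inv T \<in> borel_measurable borel"
    and \<nu>: "invariant_measure T \<nu>" and A: "A \<in> sets borel"
  shows "emeasure \<nu> (int_iterate T k -` A) = emeasure \<nu> A"
proof -
  note meas = vimage_borel[OF measurable_int_iterate[OF T] A]
  have step: "int_iterate T (i + 1) -` A = T -` (int_iterate T i -` A)" for i
    using assms(1) by (auto simp: int_iterate_commute int_iterate_plus_1)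
  have eq: "emeasure \<nu> (int_iterate T (i + 1) -` A) = emeasure \<nu> (int_iterate T i -` A)" for i
    using \<nu> meas unfolding invariant_measure_def by (simp add: step)
  show ?thesis
  proof (induction k rule: int_induct[where k = 0])
    case base
    have "int_iterate T 0 -` A = A"
      by auto
    then show ?case by simp
  next
    case (step1 i)
    then show ?case by (simp add: eq)
  next
    case (step2 i)
    then show ?case using eq[of "i - 1"] by simp
  qed
qed


section \<open>Infinite ergodic systems\<close>

locale infinite_ergodic_system =
  fixes \<mu> :: "'a::polish_space measure" and T :: "'a \<Rightarrow> 'a"
  assumes sets_\<mu> [measurable_cong, simp]: "sets \<mu> = sets borel"
    and finite_bounded: "boundedly_finite \<mu>"
    and infinite: "emeasure \<mu> UNIV = \<infinity>"
    and invertible: "invertible_mpt \<mu> T"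
    and conservative: "conservative \<mu> T"
    and ergodic: "ergodic \<mu> T"
begin

lemma space_\<mu> [simp]: "space \<mu> = UNIV"
  using sets_eq_imp_space_eq[OF sets_\<mu>] by simp

lemma bij_T: "bij T"
  using invertible by (simp add: invertible_mpt_def)

lemma measurable_T [measurable]: "T \<in> borel_measurable borel"
  and measurable_inv_T [measurable]: "inv T \<in> borel_measurable borel"
  using invertible by (auto simp: invertible_mpt_def cong: measurable_cong_sets)

lemma measurable_iterate [measurable]: "int_iterate T k \<in> borel_measurable borel"
  by (rule measurable_int_iterate) measurable

lemma invariant_\<mu>: "invariant_measure T \<mu>"
proof -
  have "emeasure \<mu> (T -` A) = emeasure \<mu> A" if "A \<in> sets borel" for A
  proof -
    have "emeasure \<mu> A = emeasure (distr \<mu> \<mu> T) A"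
      using invertible by (simp add: invertible_mpt_def)
    also have "\<dots> = emeasure \<mu> (T -` A)"
      using invertible that by (subst emeasure_distr) (auto simp: invertible_mpt_def)
    finally show ?thesis by simp
  qed
  then show ?thesis
    by (simp add: invariant_measure_def)
qed

lemmas emeasure_iterate =
  emeasure_invariant_int_iterate[OF bij_T measurable_T measurable_inv_T]

lemma vimage_iterate_borel [measurable]:
  "A \<in> sets borel \<Longrightarrow> int_iterate T k -` A \<in> sets borel"
  by (rule vimage_borel[OF measurable_iterate])

lemma orbit_saturation_borel [measurable]:
  "A \<in> sets borel \<Longrightarrow> orbit_saturation T A \<in> sets borel"
  unfolding orbit_saturation_def by (intro sets.countable_UN') auto

lemma subset_orbit_saturation: "A \<subseteq> orbit_saturation T A"
proof
  fix x assume "x \<in> A"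
  then have "x \<in> int_iterate T 0 -` A" by simp
  then show "x \<in> orbit_saturation T A"
    unfolding orbit_saturation_def by blast
qed

lemma orbit_saturation_conull:
  assumes A: "A \<in> sets borel" "emeasure \<mu> A > 0"
  shows "emeasure \<mu> (- orbit_saturation T A) = 0"
proof -
  have "emeasure \<mu> A \<le> emeasure \<mu> (orbit_saturation T A)"
    using A by (intro emeasure_mono subset_orbit_saturation) auto
  then have "emeasure \<mu> (orbit_saturation T A) \<noteq> 0"
    using A by auto
  moreover have "T -` orbit_saturation T A \<inter> space \<mu> = orbit_saturation T A"
    using vimage_orbit_saturation[OF bij_T] by simp
  ultimately show ?thesis
    using ergodic[unfolded ergodic_def, rule_format, of "orbit_saturation T A"] A(1)
    by (simp add: Compl_eq_Diff_UNIV)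
qed

lemma orbit_saturation_infinite:
  assumes A: "A \<in> sets borel" "emeasure \<mu> A > 0"
  shows "emeasure \<mu> (orbit_saturation T A) = \<infinity>"
proof -
  have "emeasure \<mu> UNIV \<le> emeasure \<mu> (orbit_saturation T A) + emeasure \<mu> (- orbit_saturation T A)"
    using A by (subst plus_emeasure) auto
  then show ?thesis
    using orbit_saturation_conull[OF A] infinite by (simp add: top_unique)
qed

text \<open>
  A Hahn decomposition of \<open>\<nu> - c \<mu>\<close> inside \<open>A\<close> yields a set \<open>F\<close> of positive measure all of whose Borel
  subsets satisfy the inequality. By invariance so do the subsets of every translate of \<open>F\<close>, and
  the translates of \<open>F\<close> cover the space up to a null set by ergodicity.
\<close>

lemma invariant_measure_dominates:
  assumes \<nu>: "invariant_measure T \<nu>"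
    and ac: "\<And>B. B \<in> sets borel \<Longrightarrow> emeasure \<mu> B = 0 \<Longrightarrow> emeasure \<nu> B = 0"
    and A: "A \<in> sets borel" "emeasure \<mu> A < \<infinity>" "emeasure \<nu> A < \<infinity>"
    and less: "c * emeasure \<mu> A < emeasure \<nu> A"
    and B: "B \<in> sets borel"
  shows "c * emeasure \<mu> B \<le> emeasure \<nu> B"
proof -
  have sets_\<nu> [simp]: "sets \<nu> = sets borel"
    using \<nu> by (simp add: invariant_measure_def)
  have "\<exists>Y\<in>sets (scale_measure c \<mu>). Y \<subseteq> A \<and>
      (\<forall>X\<in>sets (scale_measure c \<mu>). X \<subseteq> Y \<longrightarrow> emeasure \<nu> X \<le> emeasure (scale_measure c \<mu>) X) \<and>
      (\<forall>X\<in>sets (scale_measure c \<mu>). X \<subseteq> A \<longrightarrow> X \<inter> Y = {} \<longrightarrow>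
         emeasure (scale_measure c \<mu>) X \<le> emeasure \<nu> X)"
    using A less by (intro unsigned_Hahn_decomposition) auto
  then have "\<exists>Y\<in>sets borel. Y \<subseteq> A \<and>
      (\<forall>X\<in>sets borel. X \<subseteq> Y \<longrightarrow> emeasure \<nu> X \<le> c * emeasure \<mu> X) \<and>
      (\<forall>X\<in>sets borel. X \<subseteq> A \<longrightarrow> X \<inter> Y = {} \<longrightarrow> c * emeasure \<mu> X \<le> emeasure \<nu> X)"
    by simp
  then obtain Y where Y [measurable]: "Y \<in> sets borel" and "Y \<subseteq> A"
    and le: "\<forall>X\<in>sets borel. X \<subseteq> Y \<longrightarrow> emeasure \<nu> X \<le> c * emeasure \<mu> X"
    and ge: "\<forall>X\<in>sets borel. X \<subseteq> A \<longrightarrow> X \<inter> Y = {} \<longrightarrow> c * emeasure \<mu> X \<le> emeasure \<nu> X"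
    by blast
  define F where "F = A - Y"
  have F [measurable]: "F \<in> sets borel"
    using A by (simp add: F_def)
  have "emeasure \<mu> F > 0"
  proof (rule ccontr)
    assume "\<not> emeasure \<mu> F > 0"
    then have "emeasure \<nu> F = 0"
      using ac by simp
    have "emeasure \<nu> A = emeasure \<nu> Y + emeasure \<nu> F"
      using A \<open>Y \<subseteq> A\<close> by (subst plus_emeasure) (auto simp: F_def Un_absorb1)
    also have "\<dots> \<le> c * emeasure \<mu> Y"
      using le Y \<open>emeasure \<nu> F = 0\<close> by simp
    also have "\<dots> \<le> c * emeasure \<mu> A"
      using A \<open>Y \<subseteq> A\<close> by (intro mult_left_mono emeasure_mono) auto
    finally show False
      using less by simp
  qed
  have translate: "c * emeasure \<mu> X \<le> emeasure \<nu> X"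
    if X: "X \<in> sets borel" "X \<subseteq> int_iterate T k -` F" for X k
  proof -
    have "X = int_iterate T k -` (int_iterate T (- k) -` X)"
      using bij_T by auto
    moreover have "int_iterate T (- k) -` X \<subseteq> F"
    proof
      fix y assume "y \<in> int_iterate T (- k) -` X"
      then have "int_iterate T k (int_iterate T (- k) y) \<in> F"
        using X by auto
      then show "y \<in> F"
        using bij_T by simp
    qed
    then have "c * emeasure \<mu> (int_iterate T (- k) -` X) \<le> emeasure \<nu> (int_iterate T (- k) -` X)"
      using X by (intro ge[rule_format]) (auto simp: F_def)
    ultimately show ?thesis
      using emeasure_iterate[OF \<nu>, of X "- k"] emeasure_iterate[OF invariant_\<mu>, of X "- k"] X
      by simp
  qed
  \<comment> \<open>Cut \<open>B\<close> into countably many disjoint pieces, each inside one translate of \<open>F\<close>.\<close>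
  define G where "G i = B \<inter> disjointed (\<lambda>i. int_iterate T (from_nat i) -` F) i" for i :: nat
  have G [measurable]: "G i \<in> sets borel" for i
    using B sets.range_disjointed_sets'[of "\<lambda>i. int_iterate T (from_nat i) -` F" borel]
    by (auto simp: G_def image_subset_iff)
  have disj: "disjoint_family G"
    using disjoint_family_disjointed[of "\<lambda>i. int_iterate T (from_nat i) -` F"]
    by (auto simp: G_def disjoint_family_on_def)
  have "(\<Union>i::nat. int_iterate T (from_nat i) -` F) = orbit_saturation T F"
    unfolding orbit_saturation_def by auto (metis from_nat_to_nat)
  then have UG: "(\<Union>i. G i) = B \<inter> orbit_saturation T F"
    by (simp add: G_def UN_disjointed_eq flip: Int_UN_distrib)
  have "emeasure \<mu> B \<le> emeasure \<mu> (\<Union>i. G i) + emeasure \<mu> (- orbit_saturation T F)"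
    unfolding UG using B
    by (intro order_trans[OF emeasure_mono emeasure_subadditive]) auto
  then have "c * emeasure \<mu> B \<le> c * emeasure \<mu> (\<Union>i. G i)"
    using orbit_saturation_conull[OF F \<open>emeasure \<mu> F > 0\<close>] by (intro mult_left_mono) auto
  also have "\<dots> = (\<Sum>i. c * emeasure \<mu> (G i))"
    using disj by (subst suminf_emeasure[symmetric]) auto
  also have "\<dots> \<le> (\<Sum>i. emeasure \<nu> (G i))"
  proof (intro suminf_le translate G)
    show "G i \<subseteq> int_iterate T (from_nat i) -` F" for i
      using disjointed_subset[of "\<lambda>i. int_iterate T (from_nat i) -` F"] by (auto simp: G_def)
  qed auto
  also have "\<dots> = emeasure \<nu> (\<Union>i. G i)"
    using disj by (intro suminf_emeasure) auto
  also have "\<dots> \<le> emeasure \<nu> B"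
    using B by (intro emeasure_mono) (auto simp: UG)
  finally show ?thesis .
qed

text \<open>
  An atom is not wandering, so by conservativity it is a periodic point. Its orbit is then a finite
  invariant set of positive measure, conull by ergodicity, although finite sets have finite
  measure and \<open>\<mu>\<close> does not.
\<close>

lemma emeasure_singleton_eq_0: "emeasure \<mu> {x} = 0"
proof (rule ccontr)
  assume pos: "emeasure \<mu> {x} \<noteq> 0"
  have "\<not> disjoint_family (\<lambda>n::nat. (T ^^ n) -` {x} \<inter> space \<mu>)"
    using conservative[unfolded conservative_def, rule_format, of "{x}"] pos by auto
  then obtain m n y where "m \<noteq> n" "(T ^^ m) y = x" "(T ^^ n) y = x"
    unfolding disjoint_family_on_def by auto
  then obtain m n where mn: "m < n" "(T ^^ m) y = x" "(T ^^ n) y = x"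
    using linorder_neqE_nat by blast
  then have "(T ^^ (n - m + m)) y = x"
    by simp
  then have "(T ^^ (n - m)) x = x"
    unfolding funpow_add using mn(2) by simp
  then have period: "int_iterate T (int (n - m)) x = x"
    by (simp add: int_iterate_def)
  define p where "p = int (n - m)"
  have "p > 0" and p: "int_iterate T p x = x"
    using mn period by (simp_all add: p_def)
  have mult: "int_iterate T (p * q) x = x" for q
  proof (induction q rule: int_induct[where k = 0])
    case (step1 i)
    then show ?case
      using int_iterate_add[OF bij_T, of p "p * i" x] p by (simp add: algebra_simps)
  next
    case (step2 i)
    then show ?case
      using int_iterate_add[OF bij_T, of "- p" "p * i" x] int_iterate_inverse(2)[OF bij_T, of p x] p
      by (simp add: algebra_simps)
  qed simp
  have "int_iterate T k x \<in> (\<lambda>k. int_iterate T k x) ` {0..<p}" for k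
  proof
    show "int_iterate T k x = int_iterate T (k mod p) x"
      using int_iterate_add[OF bij_T, of "k mod p" "p * (k div p)" x] mult[of "k div p"] by simp
    show "k mod p \<in> {0..<p}"
      using \<open>p > 0\<close> by simp
  qed
  then have "full_orbit T x \<subseteq> (\<lambda>k. int_iterate T k x) ` {0..<p}"
    unfolding full_orbit_def by blast
  then have "finite (full_orbit T x)"
    by (rule finite_subset) simp
  then have "emeasure \<mu> (full_orbit T x) < \<infinity>"
    using finite_bounded[unfolded boundedly_finite_def] full_orbit_borel finite_imp_bounded by blast
  moreover have "orbit_saturation T {x} \<subseteq> full_orbit T x"
  proof
    fix y assume "y \<in> orbit_saturation T {x}"
    then obtain k where "int_iterate T k y = x"
      by (auto simp: orbit_saturation_def)
    then have "x \<in> full_orbit T y"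
      using int_iterate_in_full_orbit[of T k y] by simp
    then show "y \<in> full_orbit T x"
      using full_orbit_eq[OF bij_T, of x y] self_in_full_orbit[of y T] by simp
  qed
  then have "emeasure \<mu> (orbit_saturation T {x}) \<le> emeasure \<mu> (full_orbit T x)"
    by (intro emeasure_mono) (auto simp: full_orbit_borel)
  moreover have "emeasure \<mu> (orbit_saturation T {x}) = \<infinity>"
    using pos by (intro orbit_saturation_infinite) (auto simp: zero_less_iff_neq_zero)
  ultimately show False
    by (simp add: top_unique)
qed

text \<open>
  Small enough balls around any point have measure below \<open>\<epsilon>\<close> because the point is not an atom.
  Countably many of them cover the space, so they are not all null.
\<close>

lemma exists_small_set:
  assumes "\<epsilon> > (0::ennreal)"
  shows "\<exists>E\<in>sets borel. 0 < emeasure \<mu> E \<and> emeasure \<mu> E < \<epsilon>"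
proof -
  have "\<exists>n. emeasure \<mu> (ball x (1 / real (Suc n))) < \<epsilon>" for x
  proof -
    have "(INF n. emeasure \<mu> (ball x (1 / real (Suc n)))) =
        emeasure \<mu> (\<Inter>n. ball x (1 / real (Suc n)))"
    proof (rule INF_emeasure_decseq)
      show "decseq (\<lambda>n. ball x (1 / real (Suc n)))"
        by (auto simp: decseq_def intro!: subset_ball divide_left_mono)
      show "emeasure \<mu> (ball x (1 / real (Suc n))) \<noteq> \<infinity>" for n
        using finite_bounded by (auto simp: boundedly_finite_def less_top)
    qed auto
    also have "(\<Inter>n. ball x (1 / real (Suc n))) = {x}"
    proof -
      have "y = x" if "\<forall>n. dist x y < 1 / real (Suc n)" for y
      proof (rule ccontr)
        assume "y \<noteq> x"
        then obtain n where "inverse (real (Suc n)) < dist x y"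
          using reals_Archimedean[of "dist x y"] by auto
        with that[rule_format, of n] show False
          by (simp add: inverse_eq_divide)
      qed
      then show ?thesis by auto
    qed
    finally have "(INF n. emeasure \<mu> (ball x (1 / real (Suc n)))) < \<epsilon>"
      using assms by (simp add: emeasure_singleton_eq_0)
    then show ?thesis
      by (simp add: INF_less_iff)
  qed
  then obtain r where r: "\<And>x. emeasure \<mu> (ball x (1 / real (Suc (r x)))) < \<epsilon>"
    by metis
  define C where "C = range (\<lambda>x. ball x (1 / real (Suc (r x))))"
  obtain C' where C': "C' \<subseteq> C" "countable C'" "\<Union>C' = \<Union>C"
    by (rule Lindelof[of C]) (auto simp: C_def)
  have "\<Union>C = UNIV"
    by (auto simp: C_def intro!: exI centre_in_ball[THEN iffD2])
  then have "\<Union>C' = UNIV"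
    using C' by simp
  have "\<exists>E\<in>C'. emeasure \<mu> E \<noteq> 0"
  proof (rule ccontr)
    assume "\<not> ?thesis"
    then have "(\<Union>E\<in>C'. E) \<in> null_sets \<mu>"
      using C' by (intro null_sets_UN') (auto simp: null_sets_def C_def)
    with \<open>\<Union>C' = UNIV\<close> infinite show False
      by (simp add: null_sets_def)
  qed
  then obtain E where "E \<in> C'" "emeasure \<mu> E \<noteq> 0"
    by blast
  then show ?thesis
    using C' r by (intro bexI[of _ E]) (auto simp: C_def zero_less_iff_neq_zero)
qed

text \<open>
  Let \<open>D\<^sub>l\<close> be the union of the translates of \<open>E\<close> by \<open>-l, \<dots>, l\<close>. The segment of length \<open>n\<close> around a
  point of \<open>D\<^sub>l\<close> stays in \<open>D\<^sub>l\<^sub>+\<^sub>n\<close>. The measures of the \<open>D\<^sub>l\<close> increase to infinity, in steps of at most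
  \<open>2 \<mu>(E)\<close>; if \<open>E\<close> is small, they cannot jump over the interval between \<open>\<delta> / 2\<close> and \<open>\<delta>\<close>, and the
  \<open>n\<close> further steps from \<open>D\<^sub>l\<close> to \<open>D\<^sub>l\<^sub>+\<^sub>n\<close> do not leave it either.
\<close>

lemma exists_almost_invariant_set:
  assumes "\<delta> > 0"
  shows "\<exists>D\<in>sets borel. \<exists>B\<in>sets borel. (\<forall>x\<in>D. orbit_segment T n x \<subseteq> B) \<and>
    ennreal (\<delta> / 2) \<le> emeasure \<mu> D \<and> emeasure \<mu> B \<le> ennreal \<delta>"
proof -
  \<comment> \<open>One step beyond \<open>\<delta> / 2\<close> and \<open>n\<close> more cost at most \<open>2 (n + 1) \<epsilon> = \<delta> / 2\<close>.\<close>
  define \<epsilon> where "\<epsilon> = \<delta> / (4 * (real n + 1))"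
  have "\<epsilon> > 0"
    using assms by (simp add: \<epsilon>_def)
  obtain E where E [measurable]: "E \<in> sets borel" and E_pos: "0 < emeasure \<mu> E"
    and E_small: "emeasure \<mu> E < ennreal \<epsilon>"
    using exists_small_set[of "ennreal \<epsilon>"] \<open>\<epsilon> > 0\<close> by auto
  define D where "D l = (\<Union>k\<in>{- int l..int l}. int_iterate T k -` E)" for l
  have D_meas [measurable]: "D l \<in> sets borel" for l
    unfolding D_def by measurable
  have "incseq D"
    unfolding D_def incseq_def by (intro allI impI UN_mono) auto
  have "(\<Union>l. D l) = orbit_saturation T E"
  proof -
    have "int_iterate T k -` E \<subseteq> D (nat \<bar>k\<bar>)" for k
      unfolding D_def by (rule UN_upper) auto
    moreover have "D l \<subseteq> orbit_saturation T E" for l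
      by (auto simp: D_def orbit_saturation_def)
    ultimately show ?thesis
      unfolding orbit_saturation_def by blast
  qed
  then have SUP_D: "(SUP l. emeasure \<mu> (D l)) = \<infinity>"
    using \<open>incseq D\<close> orbit_saturation_infinite[OF E E_pos]
    by (subst SUP_emeasure_incseq) auto
  have "ennreal (\<delta> / 2) < (SUP l. emeasure \<mu> (D l))"
    unfolding SUP_D by simp
  then obtain l' where "ennreal (\<delta> / 2) < emeasure \<mu> (D l')"
    unfolding less_SUP_iff by blast
  define l where "l = (LEAST l. ennreal (\<delta> / 2) \<le> emeasure \<mu> (D l))"
  have l: "ennreal (\<delta> / 2) \<le> emeasure \<mu> (D l)"
    unfolding l_def using \<open>ennreal (\<delta> / 2) < emeasure \<mu> (D l')\<close>
    by (rule LeastI[OF less_imp_le])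
  have step: "emeasure \<mu> (D (Suc m)) \<le> emeasure \<mu> (D m) + ennreal (2 * \<epsilon>)" for m
  proof -
    have "{- int (Suc m)..int (Suc m)} = insert (- int (Suc m)) (insert (int (Suc m)) {- int m..int m})"
      by auto
    then have "D (Suc m) = int_iterate T (- int (Suc m)) -` E \<union> (int_iterate T (int (Suc m)) -` E \<union> D m)"
      unfolding D_def by simp
    then have "emeasure \<mu> (D (Suc m)) \<le>
        emeasure \<mu> (int_iterate T (- int (Suc m)) -` E) +
          (emeasure \<mu> (int_iterate T (int (Suc m)) -` E) + emeasure \<mu> (D m))"
      by (simp only:) (intro order_trans[OF emeasure_subadditive] add_left_mono emeasure_subadditive; simp)
    also have "\<dots> = (emeasure \<mu> E + emeasure \<mu> E) + emeasure \<mu> (D m)"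
      by (simp only: emeasure_iterate[OF invariant_\<mu> E] add.assoc)
    also have "\<dots> \<le> (ennreal \<epsilon> + ennreal \<epsilon>) + emeasure \<mu> (D m)"
      using E_small by (intro add_mono) auto
    finally show ?thesis
      using \<open>\<epsilon> > 0\<close> by (simp add: add.commute flip: ennreal_plus)
  qed
  have steps: "emeasure \<mu> (D (m + j)) \<le> emeasure \<mu> (D m) + ennreal (2 * real j * \<epsilon>)" for m j
  proof (induction j)
    case (Suc j)
    have "emeasure \<mu> (D (m + Suc j)) \<le> emeasure \<mu> (D (m + j)) + ennreal (2 * \<epsilon>)"
      using step[of "m + j"] by simp
    also have "\<dots> \<le> emeasure \<mu> (D m) + ennreal (2 * real j * \<epsilon>) + ennreal (2 * \<epsilon>)"
      using Suc by (intro add_mono) auto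
    also have "\<dots> = emeasure \<mu> (D m) + ennreal (2 * real (Suc j) * \<epsilon>)"
      using \<open>\<epsilon> > 0\<close> by (simp add: add.assoc algebra_simps flip: ennreal_plus)
    finally show ?case .
  qed simp
  have upper: "emeasure \<mu> (D l) \<le> ennreal (\<delta> / 2 + 2 * \<epsilon>)"
  proof (cases l)
    case 0
    have "D 0 = E"
      by (auto simp: D_def)
    then have "emeasure \<mu> (D l) \<le> ennreal \<epsilon>"
      using E_small 0 by simp
    also have "\<dots> \<le> ennreal (\<delta> / 2 + 2 * \<epsilon>)"
      using assms \<open>\<epsilon> > 0\<close> by (intro ennreal_leI) simp
    finally show ?thesis .
  next
    case (Suc m)
    then have "\<not> ennreal (\<delta> / 2) \<le> emeasure \<mu> (D m)"
      using not_less_Least[of m "\<lambda>l. ennreal (\<delta> / 2) \<le> emeasure \<mu> (D l)"] by (simp add: l_def)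
    then have "emeasure \<mu> (D m) + ennreal (2 * \<epsilon>) \<le> ennreal (\<delta> / 2) + ennreal (2 * \<epsilon>)"
      by (intro add_mono) auto
    then show ?thesis
      using step[of m] Suc assms \<open>\<epsilon> > 0\<close> by (simp add: order_trans flip: ennreal_plus)
  qed
  have "emeasure \<mu> (D (l + n)) \<le> ennreal (\<delta> / 2 + 2 * \<epsilon>) + ennreal (2 * real n * \<epsilon>)"
    using steps[of l n] upper by (meson add_right_mono order_trans)
  also have "\<dots> = ennreal (\<delta> / 2 + 2 * (real n + 1) * \<epsilon>)"
    using assms \<open>\<epsilon> > 0\<close> by (simp add: algebra_simps flip: ennreal_plus)
  also have "\<delta> / 2 + 2 * (real n + 1) * \<epsilon> = \<delta>"
    by (simp add: \<epsilon>_def field_simps)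
  finally have B: "emeasure \<mu> (D (l + n)) \<le> ennreal \<delta>" .
  have "orbit_segment T n x \<subseteq> D (l + n)" if "x \<in> D l" for x
  proof
    fix y assume "y \<in> orbit_segment T n x"
    then obtain j where j: "j \<in> {- int n..int n}" "y = int_iterate T j x"
      by (auto simp: orbit_segment_def)
    from that obtain k where k: "k \<in> {- int l..int l}" "int_iterate T k x \<in> E"
      by (auto simp: D_def)
    have "int_iterate T (k - j) y = int_iterate T k x"
      using int_iterate_add[OF bij_T, of "k - j" j x] j by simp
    moreover have "k - j \<in> {- int (l + n)..int (l + n)}"
      using j k by auto
    ultimately show "y \<in> D (l + n)"
      using k unfolding D_def by blast
  qed
  with l B show ?thesis
    by (intro bexI[of _ "D l"] bexI[of _ "D (l + n)"]) auto
qed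

end


section \<open>Measurability of the pair counts\<close>

lemma ball_exhaustion: "(\<Union>i. ball z (real i)) = UNIV"
proof -
  have "\<exists>i. dist z x < real i" for x
    by (rule reals_Archimedean2)
  then show ?thesis
    by auto
qed

lemma incseq_ball: "incseq (\<lambda>i. ball z (real i))"
  by (auto simp: incseq_def)

lemma boundedly_finite_sigma_finite:
  assumes "sets M = sets borel" "boundedly_finite M"
  shows "sigma_finite_measure M"
proof
  let ?A = "range (\<lambda>i::nat. ball undefined (real i))"
  have "\<Union> ?A = space M"
    using ball_exhaustion[of undefined] sets_eq_imp_space_eq[OF assms(1)] by simp
  moreover have "\<forall>a\<in>?A. emeasure M a \<noteq> \<infinity>"
    using assms(2) by (auto simp: boundedly_finite_def less_top)
  moreover have "?A \<subseteq> sets M"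
    by (simp add: assms(1) image_subset_iff)
  ultimately show "\<exists>A. countable A \<and> A \<subseteq> sets M \<and> \<Union> A = space M \<and> (\<forall>a\<in>A. emeasure M a \<noteq> \<infinity>)"
    by (intro exI[of _ ?A]) simp
qed

text \<open>
  A Dynkin class argument from rectangles to all product-measurable sets. It is run inside the
  squares \<open>b i \<times> b i\<close>, where the measures are finite and complements can be handled by subtraction.
\<close>

lemma measurable_emeasure_pair_measure:
  fixes K :: "'w \<Rightarrow> 'a::polish_space measure"
  assumes sets_K: "\<And>\<omega>. \<omega> \<in> space P \<Longrightarrow> sets (K \<omega>) = sets borel"
    and finite_K: "\<And>\<omega>. \<omega> \<in> space P \<Longrightarrow> boundedly_finite (K \<omega>)"
    and meas: "\<And>A. A \<in> sets borel \<Longrightarrow> (\<lambda>\<omega>. emeasure (K \<omega>) A) \<in> borel_measurable P"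
    and R: "R \<in> sets (borel \<Otimes>\<^sub>M borel)"
  shows "(\<lambda>\<omega>. emeasure (K \<omega> \<Otimes>\<^sub>M K \<omega>) R) \<in> borel_measurable P"
proof -
  define b where "b i = ball (undefined :: 'a) (real i)" for i
  have b [measurable]: "b i \<in> sets borel" for i
    by (simp add: b_def)
  have sets_pair: "sets (K \<omega> \<Otimes>\<^sub>M K \<omega>) = sets (borel \<Otimes>\<^sub>M borel)" if "\<omega> \<in> space P" for \<omega>
    using sets_K[OF that] by (intro sets_pair_measure_cong) auto
  have rect: "emeasure (K \<omega> \<Otimes>\<^sub>M K \<omega>) (A \<times> B) = emeasure (K \<omega>) A * emeasure (K \<omega>) B"
    if "\<omega> \<in> space P" "A \<in> sets borel" "B \<in> sets borel" for \<omega> A B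
    using that sets_K boundedly_finite_sigma_finite[OF sets_K finite_K]
    by (intro sigma_finite_measure.emeasure_pair_measure_Times) auto
  have cut: "(\<lambda>\<omega>. emeasure (K \<omega> \<Otimes>\<^sub>M K \<omega>) (R' \<inter> b i \<times> b i)) \<in> borel_measurable P"
    if R': "R' \<in> sets (borel \<Otimes>\<^sub>M borel)" for R' i
  proof -
    let ?G = "{A \<times> B | A B. A \<in> sets (borel :: 'a measure) \<and> B \<in> sets (borel :: 'a measure)}"
    have eq: "sigma_sets (UNIV \<times> UNIV) ?G = sets (borel \<Otimes>\<^sub>M borel)"
      by (simp add: sets_pair_measure)
    have closed: "?G \<subseteq> Pow (UNIV \<times> UNIV)"
      by auto
    have "R' \<in> sigma_sets (UNIV \<times> UNIV) ?G"
      unfolding eq by (rule R')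
    with Int_stable_pair_measure_generator closed show ?thesis
    proof (induction rule: sigma_sets_induct_disjoint)
      case (basic Q)
      then obtain A B where AB: "Q = A \<times> B" "A \<in> sets borel" "B \<in> sets borel"
        by blast
      have "(\<lambda>\<omega>. emeasure (K \<omega>) (A \<inter> b i) * emeasure (K \<omega>) (B \<inter> b i)) \<in> borel_measurable P"
        using AB by (intro borel_measurable_times_ennreal meas) auto
      also have "?this \<longleftrightarrow> ?case"
        using AB by (intro measurable_cong) (simp add: Times_Int_Times rect)
      finally show ?case .
    next
      case empty
      show ?case by simp
    next
      case (compl Q)
      then have Q: "Q \<in> sets (borel \<Otimes>\<^sub>M borel)"
        using eq by simp
      have "(\<lambda>\<omega>. emeasure (K \<omega>) (b i) * emeasure (K \<omega>) (b i) -
          emeasure (K \<omega> \<Otimes>\<^sub>M K \<omega>) (Q \<inter> b i \<times> b i)) \<in> borel_measurable P"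
        using compl by (intro borel_measurable_minus_ennreal borel_measurable_times_ennreal meas) auto
      also have "?this \<longleftrightarrow> ?case"
      proof (rule measurable_cong)
        fix \<omega> assume \<omega>: "\<omega> \<in> space P"
        have fin: "emeasure (K \<omega> \<Otimes>\<^sub>M K \<omega>) (b i \<times> b i) < \<infinity>"
          using \<omega> finite_K[OF \<omega>]
          by (simp add: rect boundedly_finite_def b_def ennreal_mult_less_top)
        have "emeasure (K \<omega> \<Otimes>\<^sub>M K \<omega>) (Q \<inter> b i \<times> b i) \<le> emeasure (K \<omega> \<Otimes>\<^sub>M K \<omega>) (b i \<times> b i)"
          by (intro emeasure_mono) (auto simp: sets_pair[OF \<omega>])
        then have "emeasure (K \<omega> \<Otimes>\<^sub>M K \<omega>) (b i \<times> b i - Q \<inter> b i \<times> b i) =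
            emeasure (K \<omega> \<Otimes>\<^sub>M K \<omega>) (b i \<times> b i) - emeasure (K \<omega> \<Otimes>\<^sub>M K \<omega>) (Q \<inter> b i \<times> b i)"
          using Q fin by (intro emeasure_Diff) (auto simp: sets_pair[OF \<omega>])
        moreover have "b i \<times> b i - Q \<inter> b i \<times> b i = (UNIV \<times> UNIV - Q) \<inter> b i \<times> b i"
          by auto
        ultimately show "emeasure (K \<omega>) (b i) * emeasure (K \<omega>) (b i) -
            emeasure (K \<omega> \<Otimes>\<^sub>M K \<omega>) (Q \<inter> b i \<times> b i) =
            emeasure (K \<omega> \<Otimes>\<^sub>M K \<omega>) ((UNIV \<times> UNIV - Q) \<inter> b i \<times> b i)"
          using \<omega> by (simp add: rect)
      qed
      finally show ?case .
    next
      case (union Q)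
      then have Q: "Q j \<in> sets (borel \<Otimes>\<^sub>M borel)" for j
        using eq by auto
      have "(\<lambda>\<omega>. \<Sum>j. emeasure (K \<omega> \<Otimes>\<^sub>M K \<omega>) (Q j \<inter> b i \<times> b i)) \<in> borel_measurable P"
        using union by (intro borel_measurable_suminf_order) auto
      also have "?this \<longleftrightarrow> ?case"
      proof (rule measurable_cong)
        fix \<omega> assume \<omega>: "\<omega> \<in> space P"
        show "(\<Sum>j. emeasure (K \<omega> \<Otimes>\<^sub>M K \<omega>) (Q j \<inter> b i \<times> b i)) =
            emeasure (K \<omega> \<Otimes>\<^sub>M K \<omega>) ((\<Union>j. Q j) \<inter> b i \<times> b i)"
          unfolding Int_UN_distrib2 SUP_const using Q union(1)
          by (subst suminf_emeasure) (auto simp: sets_pair[OF \<omega>] disjoint_family_on_def)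
      qed
      finally show ?case .
    qed
  qed
  have "(\<lambda>\<omega>. SUP i. emeasure (K \<omega> \<Otimes>\<^sub>M K \<omega>) (R \<inter> b i \<times> b i)) \<in> borel_measurable P"
    by (intro borel_measurable_SUP cut R) auto
  also have "?this \<longleftrightarrow> ?thesis"
  proof (rule measurable_cong)
    fix \<omega> assume \<omega>: "\<omega> \<in> space P"
    have b_mono: "b i \<subseteq> b j" if "i \<le> j" for i j
      using that by (auto simp: b_def)
    have inc: "incseq (\<lambda>i. R \<inter> b i \<times> b i)"
      unfolding incseq_def by (intro allI impI Int_mono Sigma_mono b_mono order_refl)
    have "\<exists>i. x \<in> b i" for x
      using ball_exhaustion[of undefined] unfolding b_def by blast
    then obtain h where h: "\<And>x. x \<in> b (h x)"
      by metis
    have "z \<in> (\<Union>i. R \<inter> b i \<times> b i)" if "z \<in> R" for z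
    proof (rule UN_I[of "max (h (fst z)) (h (snd z))"])
      have "fst z \<in> b (max (h (fst z)) (h (snd z)))" "snd z \<in> b (max (h (fst z)) (h (snd z)))"
        by (rule subsetD[OF b_mono h], simp)+
      with that show "z \<in> R \<inter> b (max (h (fst z)) (h (snd z))) \<times> b (max (h (fst z)) (h (snd z)))"
        by (simp add: mem_Times_iff)
    qed simp
    then have "(\<Union>i. R \<inter> b i \<times> b i) = R"
      by (intro equalityI subsetI; simp)
    then show "(SUP i. emeasure (K \<omega> \<Otimes>\<^sub>M K \<omega>) (R \<inter> b i \<times> b i)) = emeasure (K \<omega> \<Otimes>\<^sub>M K \<omega>) R"
      using inc R by (subst SUP_emeasure_incseq) (auto simp: sets_pair[OF \<omega>])
  qed
  finally show ?thesis .
qed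

section \<open>Square-integrable point processes over an infinite ergodic system\<close>

lemma emeasure_configuration_singleton:
  assumes "\<xi> \<in> configurations"
  shows "emeasure \<xi> {x} \<in> {0, 1}"
proof -
  obtain D where D: "\<And>A. A \<in> sets borel \<Longrightarrow>
      emeasure \<xi> A = (\<integral>\<^sup>+ z. emeasure (return borel z) A \<partial>count_space D)"
    using assms unfolding configurations_def by blast
  have "emeasure \<xi> {x} = (\<integral>\<^sup>+ z. indicator {x} z \<partial>count_space D)"
    by (simp add: D)
  also have "\<dots> = (\<integral>\<^sup>+ z. indicator ({x} \<inter> D) z \<partial>count_space D)"
    by (intro nn_integral_cong) (simp add: indicator_def)
  also have "\<dots> = emeasure (count_space D) ({x} \<inter> D)"
    by (intro nn_integral_indicator) simp
  also have "\<dots> \<in> {0, 1}"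
    by (cases "x \<in> D") simp_all
  finally show ?thesis .
qed

lemma emeasure_configuration_finite_le_card:
  assumes \<xi>: "\<xi> \<in> configurations" and "finite F"
  shows "emeasure \<xi> F \<le> of_nat (card F)"
proof -
  have sets_\<xi>: "sets \<xi> = sets borel"
    using \<xi> by (simp add: configurations_def)
  have "emeasure \<xi> F = (\<Sum>x\<in>F. emeasure \<xi> {x})"
    using \<open>finite F\<close> by (intro emeasure_eq_sum_singleton) (auto simp: sets_\<xi>)
  also have "\<dots> \<le> (\<Sum>x\<in>F. 1)"
  proof (rule sum_mono)
    show "emeasure \<xi> {x} \<le> 1" for x
      using emeasure_configuration_singleton[OF \<xi>, of x] by auto
  qed
  finally show ?thesis by simp
qed

lemma space_configuration_space: "space configuration_space = configurations"
  unfolding configuration_space_def by (rule space_measure_of) blast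

locale square_integrable_process = infinite_ergodic_system \<mu> T + prob_space P
  for \<mu> :: "'a::polish_space measure" and T :: "'a \<Rightarrow> 'a" and P :: "'w measure" +
  fixes S :: "'w \<Rightarrow> 'w" and N :: "'w \<Rightarrow> 'a measure"
  assumes invertible_S: "invertible_mpt P S"
    and process: "T_point_process P S \<mu> T N"
    and intensity: "\<forall>A\<in>sets \<mu>. intensity P N A = emeasure \<mu> A"
    and square_integrable: "square_integrable P \<mu> N"
begin

lemma measurable_S [measurable]: "S \<in> measurable P P"
  and distr_S: "distr P P S = P"
  using invertible_S by (simp_all add: invertible_mpt_def)

lemma measurable_N: "N \<in> measurable P configuration_space"
  using process by (simp add: T_point_process_def)

lemma N_configuration: "\<omega> \<in> space P \<Longrightarrow> N \<omega> \<in> configurations"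
  using measurable_space[OF measurable_N] by (simp add: space_configuration_space)

lemma sets_N: "\<omega> \<in> space P \<Longrightarrow> sets (N \<omega>) = sets borel"
  and boundedly_finite_N: "\<omega> \<in> space P \<Longrightarrow> boundedly_finite (N \<omega>)"
  using N_configuration by (simp_all add: configurations_def)

lemma sigma_finite_N: "\<omega> \<in> space P \<Longrightarrow> sigma_finite_measure (N \<omega>)"
  by (intro boundedly_finite_sigma_finite sets_N boundedly_finite_N)

lemma sets_pair_N:
  "\<omega> \<in> space P \<Longrightarrow> sets (N \<omega> \<Otimes>\<^sub>M N \<omega>) = sets (borel \<Otimes>\<^sub>M borel)"
  by (intro sets_pair_measure_cong sets_N)

lemma measurable_count_bounded:
  assumes A: "A \<in> sets borel" "bounded A"
  shows "(\<lambda>\<omega>. emeasure (N \<omega>) A) \<in> borel_measurable P"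
proof (rule measurableI)
  fix B :: "ennreal set" assume B: "B \<in> sets borel"
  have "{\<xi> \<in> configurations. emeasure \<xi> A \<in> B} \<in> sets configuration_space"
    unfolding configuration_space_def using A B
    by (subst sets_measure_of) (blast intro: sigma_sets.Basic)+
  from measurable_sets[OF measurable_N this]
  show "(\<lambda>\<omega>. emeasure (N \<omega>) A) -` B \<inter> space P \<in> sets P"
    by (rule back_subst[of "\<lambda>X. X \<in> sets P"]) (use N_configuration in auto)
qed simp

lemma measurable_count:
  assumes A: "A \<in> sets borel"
  shows "(\<lambda>\<omega>. emeasure (N \<omega>) A) \<in> borel_measurable P"
proof -
  define b where "b i = ball (undefined :: 'a) (real i)" for i
  have "(\<lambda>\<omega>. SUP i. emeasure (N \<omega>) (A \<inter> b i)) \<in> borel_measurable P"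
    using A by (intro borel_measurable_SUP measurable_count_bounded) (auto simp: b_def)
  also have "?this \<longleftrightarrow> ?thesis"
  proof (rule measurable_cong)
    fix \<omega> assume \<omega>: "\<omega> \<in> space P"
    have "incseq (\<lambda>i. A \<inter> b i)"
      using incseq_ball[of undefined] unfolding b_def incseq_def by blast
    moreover have "(\<Union>i. A \<inter> b i) = A"
      using ball_exhaustion[of undefined] unfolding b_def by blast
    ultimately show "(SUP i. emeasure (N \<omega>) (A \<inter> b i)) = emeasure (N \<omega>) A"
      using A by (subst SUP_emeasure_incseq) (auto simp: sets_N[OF \<omega>] b_def)
  qed
  finally show ?thesis .
qed

lemma nn_integral_count:
  "A \<in> sets borel \<Longrightarrow> (\<integral>\<^sup>+ \<omega>. emeasure (N \<omega>) A \<partial>P) = emeasure \<mu> A"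
  using intensity by (simp add: Defs.intensity_def)

lemma measurable_pair_count:
  assumes "R \<in> sets (borel \<Otimes>\<^sub>M borel)"
  shows "(\<lambda>\<omega>. emeasure (N \<omega> \<Otimes>\<^sub>M N \<omega>) R) \<in> borel_measurable P"
  using sets_N boundedly_finite_N measurable_count assms
  by (rule measurable_emeasure_pair_measure)

text \<open>
  This is the second moment measure of the process.
\<close>

definition pair_moment :: "('a \<times> 'a) set \<Rightarrow> ennreal" where
  "pair_moment R = (\<integral>\<^sup>+ \<omega>. emeasure (N \<omega> \<Otimes>\<^sub>M N \<omega>) R \<partial>P)"

lemma pair_moment_mono:
  assumes "R \<subseteq> R'" "R' \<in> sets (borel \<Otimes>\<^sub>M borel)"
  shows "pair_moment R \<le> pair_moment R'"
  unfolding pair_moment_def using assms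
  by (intro nn_integral_mono emeasure_mono) (simp_all add: sets_pair_N)

lemma pair_moment_square:
  assumes "B \<in> sets borel"
  shows "pair_moment (B \<times> B) = (\<integral>\<^sup>+ \<omega>. (emeasure (N \<omega>) B)\<^sup>2 \<partial>P)"
  unfolding pair_moment_def
proof (rule nn_integral_cong)
  fix \<omega> assume \<omega>: "\<omega> \<in> space P"
  interpret N: sigma_finite_measure "N \<omega>"
    using \<omega> by (rule sigma_finite_N)
  show "emeasure (N \<omega> \<Otimes>\<^sub>M N \<omega>) (B \<times> B) = (emeasure (N \<omega>) B)\<^sup>2"
    using assms \<omega> by (simp add: N.emeasure_pair_measure_Times sets_N power2_eq_square)
qed

text \<open>
  The equivariance of the process, read as an equality of measures, so that it can be carried over
  to the product measure.
\<close>

lemma AE_N_shift: "AE \<omega> in P. N (S \<omega>) = distr (N \<omega>) borel T"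
proof -
  have "AE \<omega> in P. \<forall>A\<in>sets \<mu>. emeasure (N (S \<omega>)) A = emeasure (N \<omega>) (T -` A \<inter> space \<mu>)"
    using process by (simp add: T_point_process_def)
  then show ?thesis
  proof (rule AE_mp, intro AE_I2 impI)
    fix \<omega> assume \<omega>: "\<omega> \<in> space P"
      and shift: "\<forall>A\<in>sets \<mu>. emeasure (N (S \<omega>)) A = emeasure (N \<omega>) (T -` A \<inter> space \<mu>)"
    have S\<omega>: "S \<omega> \<in> space P"
      using measurable_space[OF measurable_S \<omega>] .
    have T: "T \<in> measurable (N \<omega>) borel"
      using measurable_T measurable_cong_sets[OF sets_N[OF \<omega>] refl] by blast
    show "N (S \<omega>) = distr (N \<omega>) borel T"
    proof (rule measure_eqI)
      show "sets (N (S \<omega>)) = sets (distr (N \<omega>) borel T)"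
        using sets_N[OF S\<omega>] by simp
      fix A assume "A \<in> sets (N (S \<omega>))"
      then have "A \<in> sets borel"
        by (simp add: sets_N[OF S\<omega>])
      then show "emeasure (N (S \<omega>)) A = emeasure (distr (N \<omega>) borel T) A"
        using shift sets_eq_imp_space_eq[OF sets_N[OF \<omega>]] by (simp add: emeasure_distr[OF T])
    qed
  qed
qed

text \<open>
  Applying \<open>S\<close> to \<open>\<omega>\<close> leaves the expectation unchanged and moves both points of each pair by \<open>T\<close>.
\<close>

lemma pair_moment_shift:
  assumes R: "R \<in> sets (borel \<Otimes>\<^sub>M borel)"
  shows "pair_moment {(x, y). (T x, T y) \<in> R} = pair_moment R"
proof -
  have "pair_moment R = (\<integral>\<^sup>+ \<omega>. emeasure (N \<omega> \<Otimes>\<^sub>M N \<omega>) R \<partial>distr P P S)"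
    by (simp add: distr_S pair_moment_def)
  also have "\<dots> = (\<integral>\<^sup>+ \<omega>. emeasure (N (S \<omega>) \<Otimes>\<^sub>M N (S \<omega>)) R \<partial>P)"
    by (rule nn_integral_distr) (simp_all add: measurable_S measurable_pair_count[OF R])
  also have "\<dots> = (\<integral>\<^sup>+ \<omega>. emeasure (N \<omega> \<Otimes>\<^sub>M N \<omega>) {(x, y). (T x, T y) \<in> R} \<partial>P)"
  proof (rule nn_integral_cong_AE, rule AE_mp[OF AE_N_shift], intro AE_I2 impI)
    fix \<omega> assume \<omega>: "\<omega> \<in> space P" and shift: "N (S \<omega>) = distr (N \<omega>) borel T"
    have S\<omega>: "S \<omega> \<in> space P"
      using measurable_space[OF measurable_S \<omega>] .
    have T: "T \<in> measurable (N \<omega>) borel"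
      using measurable_T measurable_cong_sets[OF sets_N[OF \<omega>] refl] by blast
    have TT: "(\<lambda>(x, y). (T x, T y)) \<in> measurable (N \<omega> \<Otimes>\<^sub>M N \<omega>) (borel \<Otimes>\<^sub>M borel)"
      using T by measurable
    have space: "space (N \<omega> \<Otimes>\<^sub>M N \<omega>) = UNIV"
      using sets_eq_imp_space_eq[OF sets_N[OF \<omega>]] by (simp add: space_pair_measure)
    have "N (S \<omega>) \<Otimes>\<^sub>M N (S \<omega>) = distr (N \<omega> \<Otimes>\<^sub>M N \<omega>) (borel \<Otimes>\<^sub>M borel) (\<lambda>(x, y). (T x, T y))"
      using sigma_finite_N[OF S\<omega>] unfolding shift by (rule pair_measure_distr[OF T T])
    then have "emeasure (N (S \<omega>) \<Otimes>\<^sub>M N (S \<omega>)) R =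
        emeasure (N \<omega> \<Otimes>\<^sub>M N \<omega>) ((\<lambda>(x, y). (T x, T y)) -` R \<inter> UNIV)"
      using R by (simp only: emeasure_distr[OF TT] space)
    also have "(\<lambda>(x, y). (T x, T y)) -` R \<inter> UNIV = {(x, y). (T x, T y) \<in> R}"
      by auto
    finally show "emeasure (N (S \<omega>) \<Otimes>\<^sub>M N (S \<omega>)) R =
        emeasure (N \<omega> \<Otimes>\<^sub>M N \<omega>) {(x, y). (T x, T y) \<in> R}" .
  qed
  finally show ?thesis
    by (simp add: pair_moment_def)
qed

definition segment_pairs :: "nat \<Rightarrow> 'a set \<Rightarrow> ('a \<times> 'a) set" where
  "segment_pairs n A = {(x, y). x \<in> A \<and> y \<in> orbit_segment T n x}"

lemma segment_pairs_measurable: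
  assumes [measurable]: "A \<in> sets borel"
  shows "segment_pairs n A \<in> sets (borel \<Otimes>\<^sub>M borel)"
proof -
  have "{z \<in> space (borel \<Otimes>\<^sub>M borel). fst z \<in> A \<and> snd z = int_iterate T k (fst z)}
      \<in> sets (borel \<Otimes>\<^sub>M borel)" for k
    by measurable
  then have "(\<Union>k\<in>{- int n..int n}.
      {z \<in> space (borel \<Otimes>\<^sub>M borel). fst z \<in> A \<and> snd z = int_iterate T k (fst z)})
      \<in> sets (borel \<Otimes>\<^sub>M borel)"
    by (intro sets.finite_UN) auto
  also have "(\<Union>k\<in>{- int n..int n}.
      {z \<in> space (borel \<Otimes>\<^sub>M borel). fst z \<in> A \<and> snd z = int_iterate T k (fst z)}) =
      segment_pairs n A"
    by (auto simp: segment_pairs_def orbit_segment_def space_pair_measure)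
  finally show ?thesis .
qed

text \<open>
  A simple configuration has at most \<open>2n + 1\<close> points on an orbit segment.
\<close>

lemma pair_moment_segment_le:
  assumes A: "A \<in> sets borel"
  shows "pair_moment (segment_pairs n A) \<le> of_nat (2 * n + 1) * emeasure \<mu> A"
proof -
  have "emeasure (N \<omega> \<Otimes>\<^sub>M N \<omega>) (segment_pairs n A) \<le> of_nat (2 * n + 1) * emeasure (N \<omega>) A"
    if \<omega>: "\<omega> \<in> space P" for \<omega>
  proof -
    interpret N: sigma_finite_measure "N \<omega>"
      using \<omega> by (rule sigma_finite_N)
    have "emeasure (N \<omega> \<Otimes>\<^sub>M N \<omega>) (segment_pairs n A) =
        (\<integral>\<^sup>+ x. emeasure (N \<omega>) (Pair x -` segment_pairs n A) \<partial>N \<omega>)"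
      using segment_pairs_measurable[OF A] by (intro N.emeasure_pair_measure_alt) (simp add: sets_pair_N[OF \<omega>])
    also have "\<dots> \<le> (\<integral>\<^sup>+ x. of_nat (2 * n + 1) * indicator A x \<partial>N \<omega>)"
    proof (rule nn_integral_mono)
      fix x
      have "emeasure (N \<omega>) (orbit_segment T n x) \<le> of_nat (card (orbit_segment T n x))"
        by (intro emeasure_configuration_finite_le_card N_configuration \<omega> card_orbit_segment_le)
      also have "\<dots> \<le> of_nat (2 * n + 1)"
        using card_orbit_segment_le by (simp only: of_nat_le_iff)
      finally have "emeasure (N \<omega>) (orbit_segment T n x) \<le> of_nat (2 * n + 1)" .
      moreover have "Pair x -` segment_pairs n A = (if x \<in> A then orbit_segment T n x else {})"
        by (auto simp: segment_pairs_def)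
      ultimately show "emeasure (N \<omega>) (Pair x -` segment_pairs n A) \<le> of_nat (2 * n + 1) * indicator A x"
        by simp
    qed
    also have "\<dots> = of_nat (2 * n + 1) * emeasure (N \<omega>) A"
      using A by (intro nn_integral_cmult_indicator) (simp add: sets_N[OF \<omega>])
    finally show ?thesis .
  qed
  then have "pair_moment (segment_pairs n A) \<le> (\<integral>\<^sup>+ \<omega>. of_nat (2 * n + 1) * emeasure (N \<omega>) A \<partial>P)"
    unfolding pair_moment_def by (rule nn_integral_mono)
  also have "\<dots> = of_nat (2 * n + 1) * emeasure \<mu> A"
    using A by (simp only: nn_integral_cmult[OF measurable_count] nn_integral_count)
  finally show ?thesis .
qed

text \<open>
  The measure \<open>\<rho>\<^sub>n\<close> of the introduction.
\<close>

definition segment_measure :: "nat \<Rightarrow> 'a measure" where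
  "segment_measure n = measure_of UNIV (sets borel) (\<lambda>A. pair_moment (segment_pairs n A))"

lemma sets_segment_measure [simp]: "sets (segment_measure n) = sets borel"
  unfolding segment_measure_def
  using sets.sigma_sets_eq[of "borel :: 'a measure"] by (subst sets_measure_of) auto

lemma emeasure_segment_measure:
  assumes A: "A \<in> sets borel"
  shows "emeasure (segment_measure n) A = pair_moment (segment_pairs n A)"
  unfolding segment_measure_def
proof (rule emeasure_measure_of_sigma)
  show "sigma_algebra UNIV (sets (borel :: 'a measure))"
    using sets.sigma_algebra_axioms[of "borel :: 'a measure"] by simp
  show "positive (sets borel) (\<lambda>A. pair_moment (segment_pairs n A))"
    by (simp add: positive_def pair_moment_def segment_pairs_def)
  show "countably_additive (sets borel) (\<lambda>A. pair_moment (segment_pairs n A))"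
  proof (rule countably_additiveI)
    fix F :: "nat \<Rightarrow> 'a set"
    assume F: "range F \<subseteq> sets borel" "disjoint_family F"
    have meas: "segment_pairs n (F i) \<in> sets (borel \<Otimes>\<^sub>M borel)" for i
      using F by (intro segment_pairs_measurable) auto
    have disj: "disjoint_family (\<lambda>i. segment_pairs n (F i))"
      using F(2) unfolding disjoint_family_on_def segment_pairs_def by blast
    have UN: "segment_pairs n (\<Union>i. F i) = (\<Union>i. segment_pairs n (F i))"
      unfolding segment_pairs_def by blast
    have "(\<Sum>i. pair_moment (segment_pairs n (F i))) =
        (\<integral>\<^sup>+ \<omega>. (\<Sum>i. emeasure (N \<omega> \<Otimes>\<^sub>M N \<omega>) (segment_pairs n (F i))) \<partial>P)"
      unfolding pair_moment_def
      by (intro nn_integral_suminf[symmetric] measurable_pair_count meas)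
    also have "\<dots> = pair_moment (segment_pairs n (\<Union>i. F i))"
      unfolding pair_moment_def UN using disj meas
      by (intro nn_integral_cong suminf_emeasure) (auto simp: sets_pair_N)
    finally show "(\<Sum>i. pair_moment (segment_pairs n (F i))) = pair_moment (segment_pairs n (\<Union>i. F i))" .
  qed
qed (rule A)

lemma invariant_segment_measure: "invariant_measure T (segment_measure n)"
  unfolding invariant_measure_def
proof (intro conjI ballI)
  fix A :: "'a set" assume A: "A \<in> sets borel"
  have "segment_pairs n (T -` A) = {(x, y). (T x, T y) \<in> segment_pairs n A}"
    using orbit_segment_step[OF bij_T] by (auto simp: segment_pairs_def)
  then show "emeasure (segment_measure n) (T -` A) = emeasure (segment_measure n) A"
    using vimage_borel[OF measurable_T A] A
    by (simp add: emeasure_segment_measure pair_moment_shift segment_pairs_measurable)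
qed simp

text \<open>
  Otherwise there are sets \<open>F\<^sub>n\<close> with \<open>\<mu>(F\<^sub>n) \<le> 2\<^sup>-\<^sup>n\<close> and \<open>E[N(F\<^sub>n)\<^sup>2] > n\<close>. Their union has finite measure
  and infinite second moment.
\<close>

lemma second_moment_uniform_bound:
  "\<exists>\<delta>>0. \<exists>K\<ge>0. \<forall>A\<in>sets borel. emeasure \<mu> A \<le> ennreal \<delta> \<longrightarrow>
     (\<integral>\<^sup>+ \<omega>. (emeasure (N \<omega>) A)\<^sup>2 \<partial>P) \<le> ennreal K"
proof (rule ccontr)
  assume neg: "\<not> ?thesis"
  have "\<exists>A\<in>sets borel. emeasure \<mu> A \<le> ennreal ((1 / 2) ^ n) \<and>
      ennreal (real n) < (\<integral>\<^sup>+ \<omega>. (emeasure (N \<omega>) A)\<^sup>2 \<partial>P)" for n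
  proof (rule ccontr)
    assume "\<not> ?thesis"
    then have "\<forall>A\<in>sets borel. emeasure \<mu> A \<le> ennreal ((1 / 2) ^ n) \<longrightarrow>
        (\<integral>\<^sup>+ \<omega>. (emeasure (N \<omega>) A)\<^sup>2 \<partial>P) \<le> ennreal (real n)"
      using not_le by blast
    moreover have "(1 / 2 :: real) ^ n > 0" "real n \<ge> 0"
      by simp_all
    ultimately show False
      using neg by blast
  qed
  then obtain F where F: "\<And>n. F n \<in> sets borel"
    and small: "\<And>n. emeasure \<mu> (F n) \<le> ennreal ((1 / 2) ^ n)"
    and large: "\<And>n. ennreal (real n) < (\<integral>\<^sup>+ \<omega>. (emeasure (N \<omega>) (F n))\<^sup>2 \<partial>P)"
    by metis
  define A where "A = (\<Union>n. F n)"
  have A: "A \<in> sets borel"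
    using F by (auto simp: A_def)
  have "emeasure \<mu> A \<le> (\<Sum>n. emeasure \<mu> (F n))"
    unfolding A_def using F by (intro emeasure_subadditive_countably) auto
  also have "\<dots> \<le> (\<Sum>n. ennreal ((1 / 2) ^ n))"
    by (intro suminf_le small) auto
  also have "\<dots> = ennreal (\<Sum>n. (1 / 2) ^ n)"
    by (intro suminf_ennreal2) auto
  finally have fin: "emeasure \<mu> A < \<infinity>"
    by (rule le_less_trans) simp
  have unbounded: "of_nat n \<le> (\<integral>\<^sup>+ \<omega>. (emeasure (N \<omega>) A)\<^sup>2 \<partial>P)" for n
  proof -
    have "(\<integral>\<^sup>+ \<omega>. (emeasure (N \<omega>) (F n))\<^sup>2 \<partial>P) \<le> (\<integral>\<^sup>+ \<omega>. (emeasure (N \<omega>) A)\<^sup>2 \<partial>P)"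
      using A by (intro nn_integral_mono power_mono emeasure_mono) (auto simp: sets_N A_def)
    with large[of n] show ?thesis
      by (simp add: ennreal_of_nat_eq_real_of_nat)
  qed
  have "(\<integral>\<^sup>+ \<omega>. (emeasure (N \<omega>) A)\<^sup>2 \<partial>P) < \<infinity>"
  \<comment> \<open>Square integrability speaks of sets of positive measure only; on a null set \<open>N\<close> vanishes.\<close>
  proof (cases "emeasure \<mu> A = 0")
    case True
    then have "AE \<omega> in P. emeasure (N \<omega>) A = 0"
      using process A by (simp add: T_point_process_def)
    then have "(\<integral>\<^sup>+ \<omega>. (emeasure (N \<omega>) A)\<^sup>2 \<partial>P) = (\<integral>\<^sup>+ \<omega>. 0 \<partial>P)"
      by (intro nn_integral_cong_AE) auto
    then show ?thesis by simp
  next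
    case False
    then have "A \<in> finite_positive_sets \<mu>"
      using A fin by (simp add: finite_positive_sets_def zero_less_iff_neq_zero)
    then show ?thesis
      using square_integrable by (simp add: square_integrable_def)
  qed
  then obtain n where "(\<integral>\<^sup>+ \<omega>. (emeasure (N \<omega>) A)\<^sup>2 \<partial>P) < of_nat n"
    using ennreal_Ex_less_of_nat by auto
  with unbounded[of n] show False
    by simp
qed

text \<open>
  The heart of the proof: the constant \<open>C\<close> does not depend on \<open>n\<close>. If \<open>\<rho>\<^sub>n\<close> exceeded \<open>C \<mu>\<close> somewhere, it
  would dominate \<open>C \<mu>\<close> everywhere, in particular on an almost invariant set \<open>D\<close>. But the pairs counted
  by \<open>\<rho>\<^sub>n(D)\<close> lie in \<open>B \<times> B\<close> with \<open>\<mu>(B) \<le> \<delta>\<close>, and there are at most \<open>K\<close> of them on average.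
\<close>

lemma pair_moment_segment_uniform_bound:
  "\<exists>C. \<forall>n. \<forall>A\<in>sets borel. emeasure \<mu> A < \<infinity> \<longrightarrow>
     pair_moment (segment_pairs n A) \<le> ennreal C * emeasure \<mu> A"
proof -
  obtain \<delta> K where "\<delta> > 0" "K \<ge> 0"
    and K: "\<forall>A\<in>sets borel. emeasure \<mu> A \<le> ennreal \<delta> \<longrightarrow>
       (\<integral>\<^sup>+ \<omega>. (emeasure (N \<omega>) A)\<^sup>2 \<partial>P) \<le> ennreal K"
    using second_moment_uniform_bound by (elim exE conjE) (rule that)
  \<comment> \<open>Chosen so that \<open>C \<mu>(D) \<ge> C \<delta> / 2 = K + 1 > K\<close>.\<close>
  define C where "C = 2 * (K + 1) / \<delta>"
  have "pair_moment (segment_pairs n A) \<le> ennreal C * emeasure \<mu> A"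
    if A: "A \<in> sets borel" "emeasure \<mu> A < \<infinity>" for n A
  proof (rule ccontr)
    assume neg: "\<not> ?thesis"
    obtain D B where D: "D \<in> sets borel" and B: "B \<in> sets borel"
      and seg: "\<forall>x\<in>D. orbit_segment T n x \<subseteq> B"
      and D_large: "ennreal (\<delta> / 2) \<le> emeasure \<mu> D" and B_small: "emeasure \<mu> B \<le> ennreal \<delta>"
      using exists_almost_invariant_set[OF \<open>\<delta> > 0\<close>, where n = n] by (elim bexE conjE) (rule that)
    have "ennreal C * emeasure \<mu> D \<le> emeasure (segment_measure n) D"
    proof (rule invariant_measure_dominates[OF invariant_segment_measure _ A])
      show "emeasure (segment_measure n) B = 0" if "B \<in> sets borel" "emeasure \<mu> B = 0" for B
        using pair_moment_segment_le[of B n] that by (simp add: emeasure_segment_measure)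
      show "emeasure (segment_measure n) A < \<infinity>"
        unfolding emeasure_segment_measure[OF A(1)]
        by (rule le_less_trans[OF pair_moment_segment_le[OF A(1)]])
          (use A(2) in \<open>simp add: ennreal_mult_less_top of_nat_less_top del: of_nat_Suc of_nat_add\<close>)
      show "ennreal C * emeasure \<mu> A < emeasure (segment_measure n) A"
        using neg A by (simp add: emeasure_segment_measure)
    qed (rule D)
    also have "\<dots> = pair_moment (segment_pairs n D)"
      by (rule emeasure_segment_measure[OF D])
    also have "\<dots> \<le> pair_moment (B \<times> B)"
    proof (rule pair_moment_mono)
      have "x \<in> orbit_segment T n x" for x
        unfolding orbit_segment_def by (rule image_eqI[of _ _ 0]) simp_all
      then show "segment_pairs n D \<subseteq> B \<times> B"
        using seg unfolding segment_pairs_def by blast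
    qed (use B in simp)
    also have "\<dots> \<le> ennreal K"
      using K B B_small by (simp add: pair_moment_square)
    finally have "ennreal C * emeasure \<mu> D \<le> ennreal K" .
    moreover have "ennreal C * ennreal (\<delta> / 2) \<le> ennreal C * emeasure \<mu> D"
      by (intro mult_left_mono D_large) simp
    moreover have "ennreal C * ennreal (\<delta> / 2) = ennreal (K + 1)"
    proof -
      have "C \<ge> 0" "C * (\<delta> / 2) = K + 1"
        using \<open>\<delta> > 0\<close> \<open>K \<ge> 0\<close> by (simp_all add: C_def)
      moreover have "\<delta> / 2 \<ge> 0"
        using \<open>\<delta> > 0\<close> by simp
      ultimately show ?thesis
        by (metis ennreal_mult)
    qed
    ultimately have "ennreal (K + 1) \<le> ennreal K"
      by simp
    then show False
      using \<open>K \<ge> 0\<close> by (simp add: ennreal_le_iff del: ennreal_plus)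
  qed
  then show ?thesis
    by blast
qed

definition orbit_pairs :: "'a set \<Rightarrow> ('a \<times> 'a) set" where
  "orbit_pairs A = {(x, y). x \<in> A \<and> y \<in> full_orbit T x}"

lemma orbit_pairs_eq_UN: "orbit_pairs A = (\<Union>n. segment_pairs n A)"
proof -
  have "(x, y) \<in> orbit_pairs A \<longleftrightarrow> (x, y) \<in> (\<Union>n. segment_pairs n A)" for x y
    by (auto simp: orbit_pairs_def segment_pairs_def simp flip: Union_orbit_segment)
  then show ?thesis
    by auto
qed

lemma orbit_pairs_measurable: "A \<in> sets borel \<Longrightarrow> orbit_pairs A \<in> sets (borel \<Otimes>\<^sub>M borel)"
  unfolding orbit_pairs_eq_UN by (intro sets.countable_UN') (auto intro: segment_pairs_measurable)

lemma AE_orbit_pairs_finite: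
  assumes A: "A \<in> sets borel" "emeasure \<mu> A < \<infinity>"
  shows "AE \<omega> in P. emeasure (N \<omega> \<Otimes>\<^sub>M N \<omega>) (orbit_pairs A) < \<infinity>"
proof -
  obtain C where C: "\<And>n. pair_moment (segment_pairs n A) \<le> ennreal C * emeasure \<mu> A"
    using pair_moment_segment_uniform_bound A by blast
  have inc: "incseq (\<lambda>n. segment_pairs n A)"
    using orbit_segment_mono[of _ _ T] unfolding incseq_def segment_pairs_def by blast
  have emeasure_SUP: "emeasure (N \<omega> \<Otimes>\<^sub>M N \<omega>) (orbit_pairs A) =
      (SUP n. emeasure (N \<omega> \<Otimes>\<^sub>M N \<omega>) (segment_pairs n A))" if "\<omega> \<in> space P" for \<omega>
    unfolding orbit_pairs_eq_UN using that inc segment_pairs_measurable[OF A(1)]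
    by (intro SUP_emeasure_incseq[symmetric]) (auto simp: sets_pair_N)
  have "pair_moment (orbit_pairs A) =
      (\<integral>\<^sup>+ \<omega>. (SUP n. emeasure (N \<omega> \<Otimes>\<^sub>M N \<omega>) (segment_pairs n A)) \<partial>P)"
    unfolding pair_moment_def by (intro nn_integral_cong emeasure_SUP)
  also have "\<dots> = (SUP n. pair_moment (segment_pairs n A))"
    unfolding pair_moment_def
  proof (intro nn_integral_monotone_convergence_SUP_AE measurable_pair_count segment_pairs_measurable A AE_I2)
    fix n \<omega> assume "\<omega> \<in> space P"
    then show "emeasure (N \<omega> \<Otimes>\<^sub>M N \<omega>) (segment_pairs n A) \<le>
        emeasure (N \<omega> \<Otimes>\<^sub>M N \<omega>) (segment_pairs (Suc n) A)"
      using incseqD[OF inc, of n "Suc n"] segment_pairs_measurable[OF A(1)]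
      by (intro emeasure_mono) (auto simp: sets_pair_N)
  qed
  also have "\<dots> \<le> ennreal C * emeasure \<mu> A"
    by (intro SUP_least C)
  also have "\<dots> < \<infinity>"
    using A by (simp add: ennreal_mult_less_top)
  finally have "AE \<omega> in P. emeasure (N \<omega> \<Otimes>\<^sub>M N \<omega>) (orbit_pairs A) \<noteq> \<infinity>"
    unfolding pair_moment_def
    by (intro nn_integral_PInf_AE measurable_pair_count orbit_pairs_measurable A) simp
  then show ?thesis
    by (simp add: less_top)
qed

lemma AE_finite_on_orbits: "AE \<omega> in P. \<forall>x. emeasure (N \<omega>) (full_orbit T x) < \<infinity>"
proof -
  define b where "b i = ball (undefined :: 'a) (real i)" for i
  have b: "b i \<in> sets borel" "emeasure \<mu> (b i) < \<infinity>" for i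
    using finite_bounded by (auto simp: b_def boundedly_finite_def)
  have "AE \<omega> in P. \<forall>i. emeasure (N \<omega> \<Otimes>\<^sub>M N \<omega>) (orbit_pairs (b i)) < \<infinity>"
    unfolding AE_all_countable by (intro allI AE_orbit_pairs_finite b)
  then show ?thesis
  proof (rule AE_mp, intro AE_I2 impI allI)
    fix \<omega> x assume \<omega>: "\<omega> \<in> space P"
      and fin: "\<forall>i. emeasure (N \<omega> \<Otimes>\<^sub>M N \<omega>) (orbit_pairs (b i)) < \<infinity>"
    interpret N: sigma_finite_measure "N \<omega>"
      using \<omega> by (rule sigma_finite_N)
    have orbit [simp]: "full_orbit T y \<in> sets (N \<omega>)" for y
      by (simp add: sets_N[OF \<omega>] full_orbit_borel)
    show "emeasure (N \<omega>) (full_orbit T x) < \<infinity>"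
    proof (cases "\<exists>y\<in>full_orbit T x. emeasure (N \<omega>) {y} \<noteq> 0")
      case True
      then obtain y where y: "y \<in> full_orbit T x" "emeasure (N \<omega>) {y} = 1"
        using emeasure_configuration_singleton[OF N_configuration[OF \<omega>]] by blast
      obtain i where i: "y \<in> b i"
        using ball_exhaustion[of undefined] unfolding b_def by blast
      \<comment> \<open>The pairs with first point \<open>y\<close> alone are as numerous as the points on the orbit.\<close>
      have "emeasure (N \<omega>) (full_orbit T x) = emeasure (N \<omega>) {y} * emeasure (N \<omega>) (full_orbit T y)"
        using y full_orbit_eq[OF bij_T y(1)] by simp
      also have "\<dots> = emeasure (N \<omega> \<Otimes>\<^sub>M N \<omega>) ({y} \<times> full_orbit T y)"
        by (intro N.emeasure_pair_measure_Times[symmetric] orbit) (simp add: sets_N[OF \<omega>])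
      also have "\<dots> \<le> emeasure (N \<omega> \<Otimes>\<^sub>M N \<omega>) (orbit_pairs (b i))"
        using i orbit_pairs_measurable[OF b(1)]
        by (intro emeasure_mono) (auto simp: orbit_pairs_def sets_pair_N[OF \<omega>])
      also have "\<dots> < \<infinity>"
        using fin by blast
      finally show ?thesis .
    next
      case False
      have "full_orbit T x = range (\<lambda>k. int_iterate T k x)"
        by (auto simp: full_orbit_def)
      then have "countable (full_orbit T x)"
        by simp
      then have "(\<Union>y\<in>full_orbit T x. {y}) \<in> null_sets (N \<omega>)"
        using False by (intro null_sets_UN') (auto simp: null_sets_def sets_N[OF \<omega>])
      then show ?thesis
        by (simp add: null_sets_def)
    qed
  qed
qed

end

theorem proposition2p1:
  fixes \<mu> :: "'a::polish_space measure"
    and T :: "'a \<Rightarrow> 'a"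
    and P :: "'w measure"
    and S :: "'w \<Rightarrow> 'w"
    and N :: "'w \<Rightarrow> 'a measure"
  assumes "sets \<mu> = sets borel"
    and "boundedly_finite \<mu>"
    and "emeasure \<mu> UNIV = \<infinity>"
    and "invertible_mpt \<mu> T"
    and "conservative \<mu> T"
    and "ergodic \<mu> T"
    and "prob_space P"
    and "invertible_mpt P S"
    and "T_point_process P S \<mu> T N"
    and "\<forall>A\<in>sets \<mu>. intensity P N A = emeasure \<mu> A"
    and "square_integrable P \<mu> N"
  shows "AE \<omega> in P. \<forall>x. emeasure (N \<omega>) (full_orbit T x) < \<infinity>"
proof -
  interpret prob_space P
    by fact
  interpret square_integrable_process \<mu> T P S N
    by unfold_locales fact+
  show ?thesis
    by (rule AE_finite_on_orbits)
qed

end
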